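(* Let $0<p<1$ be a constant, let $r\ge 2$ be a fixed integer, and let $G=\mathbb{G}(n,p)$. Then for any fixed integer $\ell\ge 3$, with high probability \[ \kappa_{r,\ell}(G) \sim \min\left\{ \frac{n}{\ell-1},\; np\left(1-\frac{p}{2}\right)\right\}. \]
   Context: $\mathbb{G}(n,p)$ is the random graph on $n$ vertices in which each pair of vertices is an edge independently with probability $p$. A path is alternating (with respect to an edge-coloring) if no two consecutive edges of the path have the same color; the length of a path is its number of edges. For a graph $G$, $\kappa_{r,\ell}(G)$ is the maximum $t$ such that there is an $r$-edge-coloring of $G$ in which every pair of distinct vertices is connected by $t$ internally vertex-disjoint alternating paths of length $\ell$. All asymptotics are as $n\to\infty$; $f\sim g$ means $f=(1+o(1))g$; "with high probability" means with probability tending to $1$ as $n\to\infty$. *)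

theory Defs
  imports "HOL-Probability.Probability"
begin

text \<open>
  A simple graph is given by its vertex set \<open>V\<close> and its edge set \<open>E\<close>, a set of two-element subsets
  of \<open>V\<close>.
\<close>

definition vertex_pairs :: "'a set \<Rightarrow> 'a set set" where
  "vertex_pairs V = {e. e \<subseteq> V \<and> card e = 2}"

text \<open>
  The random graph on the vertex set \<open>{..<n}\<close>, as a distribution on edge sets: \<open>Pi_pmf\<close> is the
  product of independent coin flips, one for each pair of vertices; it takes the value \<open>False\<close>
  outside the index set.
\<close>

definition random_graph :: "nat \<Rightarrow> real \<Rightarrow> nat set set pmf" where
  "random_graph n p =
     map_pmf (\<lambda>f. {e \<in> vertex_pairs {..<n}. f e})
       (Pi_pmf (vertex_pairs {..<n}) False (\<lambda>_. bernoulli_pmf p))"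

text \<open>A path is the list of its vertices; its length, as a number of edges, is \<open>length xs - 1\<close>.\<close>

definition is_path :: "'a set \<Rightarrow> 'a set set \<Rightarrow> 'a list \<Rightarrow> bool" where
  "is_path V E xs \<longleftrightarrow> xs \<noteq> [] \<and> distinct xs \<and> set xs \<subseteq> V \<and>
     (\<forall>i. Suc i < length xs \<longrightarrow> {xs ! i, xs ! Suc i} \<in> E)"

definition alternating :: "('a set \<Rightarrow> nat) \<Rightarrow> 'a list \<Rightarrow> bool" where
  "alternating c xs \<longleftrightarrow>
     (\<forall>i. Suc (Suc i) < length xs \<longrightarrow>
        c {xs ! i, xs ! Suc i} \<noteq> c {xs ! Suc i, xs ! Suc (Suc i)})"

definition alternating_paths ::
  "'a set \<Rightarrow> 'a set set \<Rightarrow> ('a set \<Rightarrow> nat) \<Rightarrow> nat \<Rightarrow> 'a \<Rightarrow> 'a \<Rightarrow> 'a list set" where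
  "alternating_paths V E c l u v =
     {xs. is_path V E xs \<and> length xs = l + 1 \<and> hd xs = u \<and> last xs = v \<and> alternating c xs}"

definition interior_vertices :: "'a list \<Rightarrow> 'a set" where
  "interior_vertices xs = set (butlast (tl xs))"

definition internally_disjoint :: "'a list set \<Rightarrow> bool" where
  "internally_disjoint Ps \<longleftrightarrow>
     pairwise (\<lambda>xs ys. disjnt (interior_vertices xs) (interior_vertices ys)) Ps"

text \<open>Edge colorings need not be proper.\<close>

definition edge_coloring :: "nat \<Rightarrow> 'a set set \<Rightarrow> ('a set \<Rightarrow> nat) \<Rightarrow> bool" where
  "edge_coloring r E c \<longleftrightarrow> c ` E \<subseteq> {..<r}"

definition alternating_connected ::
  "'a set \<Rightarrow> 'a set set \<Rightarrow> ('a set \<Rightarrow> nat) \<Rightarrow> nat \<Rightarrow> nat \<Rightarrow> bool" where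
  "alternating_connected V E c l t \<longleftrightarrow>
     (\<forall>u\<in>V. \<forall>v\<in>V. u \<noteq> v \<longrightarrow>
        (\<exists>Ps \<subseteq> alternating_paths V E c l u v.
           finite Ps \<and> card Ps = t \<and> internally_disjoint Ps))"

text \<open>
  The maximum exists if \<open>V\<close> is finite with at least two vertices and \<open>r \<ge> 1\<close>, see
  \<open>kappa_attained\<close> and \<open>kappa_upper\<close> below. With fewer than two vertices every \<open>t\<close> qualifies and the
  value is meaningless.
\<close>

definition kappa :: "nat \<Rightarrow> nat \<Rightarrow> 'a set \<Rightarrow> 'a set set \<Rightarrow> nat" where
  "kappa r l V E = Max {t. \<exists>c. edge_coloring r E c \<and> alternating_connected V E c l t}"

lemma finite_alternating_paths:
  assumes "finite V"
  shows "finite (alternating_paths V E c l u v)"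
  by (rule finite_subset[OF _ finite_lists_length_eq[OF assms, of "l + 1"]])
     (auto simp: alternating_paths_def is_path_def)

lemma finite_kappa_set:
  assumes "finite V" "card V \<ge> 2"
  shows "finite {t. \<exists>c. edge_coloring r E c \<and> alternating_connected V E c l t}"
proof -
  obtain u v where uv: "u \<in> V" "v \<in> V" "u \<noteq> v"
    using assms by (metis card_2_iff' ex_card subsetD)
  let ?L = "{xs. set xs \<subseteq> V \<and> length xs = l + 1}"
  have "t \<le> card ?L" if "alternating_connected V E c l t" for c t
  proof -
    obtain Ps where "Ps \<subseteq> alternating_paths V E c l u v" "card Ps = t"
      using \<open>alternating_connected V E c l t\<close> uv unfolding alternating_connected_def by blast
    then show ?thesis
      using card_mono[OF finite_lists_length_eq[OF assms(1), of "l + 1"], of Ps]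
      by (auto simp: alternating_paths_def is_path_def)
  qed
  then show ?thesis by (auto intro!: finite_subset[of _ "{..card ?L}"])
qed

lemma kappa_attained:
  assumes "finite V" "card V \<ge> 2" "r \<ge> 1"
  shows "\<exists>c. edge_coloring r E c \<and> alternating_connected V E c l (kappa r l V E)"
proof -
  have "edge_coloring r E (\<lambda>_. 0) \<and> alternating_connected V E (\<lambda>_. 0) l 0"
    using assms(3)
    by (auto simp: edge_coloring_def alternating_connected_def internally_disjoint_def
             intro!: exI[of _ "{}"])
  then show ?thesis
    using Max_in[OF finite_kappa_set[OF assms(1,2), of r E l]] unfolding kappa_def by blast
qed

lemma kappa_upper:
  assumes "finite V" "card V \<ge> 2" "edge_coloring r E c" "alternating_connected V E c l t"
  shows "t \<le> kappa r l V E"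
  unfolding kappa_def using assms(3,4) by (intro Max_ge finite_kappa_set[OF assms(1,2)]) blast

definition with_high_probability :: "(nat \<Rightarrow> 'b pmf) \<Rightarrow> (nat \<Rightarrow> 'b \<Rightarrow> bool) \<Rightarrow> bool" where
  "with_high_probability M P \<longleftrightarrow> (\<lambda>n. measure_pmf.prob (M n) {x. P n x}) \<longlonglongrightarrow> 1"

text \<open>
  \<open>X n = (1 + o(1)) g n\<close> with high probability: the error term depends on the random outcome, and
  is bounded by a deterministic sequence tending to 0.
\<close>

definition whp_asymp_equiv ::
  "(nat \<Rightarrow> 'b pmf) \<Rightarrow> (nat \<Rightarrow> 'b \<Rightarrow> real) \<Rightarrow> (nat \<Rightarrow> real) \<Rightarrow> bool" where
  "whp_asymp_equiv M X g \<longleftrightarrow>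
     (\<exists>\<delta>. \<delta> \<longlonglongrightarrow> 0 \<and> with_high_probability M (\<lambda>n x. \<bar>X n x - g n\<bar> \<le> \<delta> n * \<bar>g n\<bar>))"

end

theory Submission
  imports Defs "HOL-Real_Asymp.Real_Asymp"
begin

text \<open>
  Upper bound: the interiors of \<open>t\<close> disjoint paths of length \<open>l\<close> from \<open>u\<close> to \<open>v\<close> have \<open>t (l - 1)\<close> vertices
  in total, and each contains two vertices adjacent to \<open>u\<close> or \<open>v\<close>, of which there are about
  \<open>n (1 - (1 - p)\<^sup>2) = 2 n p (1 - p / 2)\<close>.

  Lower bound: color the edges of the random graph by two colors uniformly at random. With high
  probability, any two disjoint sets of \<open>n powr (3 / 4)\<close> vertices are joined by an edge of each color, and
  all pairs \<open>u\<close>, \<open>v\<close> have about the expected number of vertices of each kind of adjacency to \<open>u\<close> and \<open>v\<close>.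
  By the latter one can choose disjoint sets of neighbours of \<open>u\<close> and of \<open>v\<close>, of nearly half the
  claimed size for each color, together with disjoint intermediate layers of the same size. By the
  former, paths through the layers with prescribed colors can be removed greedily until only
  \<open>O(n powr (3 / 4))\<close> vertices are left in each layer.
\<close>


subsection \<open>Disjoint transversals\<close>

text \<open>Induction along the layers: if at least \<open>m\<close> vertices of layer
  \<open>j'\<close> end a partial transversal, then fewer than \<open>m\<close> vertices of the next
  layer are unreachable, since otherwise \<open>sep\<close> would join a reached vertex to an
  unreached one. With \<open>2 * m\<close> vertices per layer, at least \<open>m\<close> are reached
  again.\<close>

lemma transversal_path:
  fixes R :: "nat \<Rightarrow> 'a \<Rightarrow> 'a \<Rightarrow> bool"
  assumes "m \<ge> 1"
    and fin: "\<And>i. i \<le> j \<Longrightarrow> finite (L i)"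
    and large: "\<And>i. i \<le> j \<Longrightarrow> 2 * m \<le> card (L i)"
    and sep: "\<And>i A B. \<lbrakk>i < j; A \<subseteq> L i; B \<subseteq> L (Suc i); m \<le> card A; m \<le> card B\<rbrakk>
                \<Longrightarrow> \<exists>x\<in>A. \<exists>y\<in>B. R i x y"
  shows "\<exists>g. (\<forall>i\<le>j. g i \<in> L i) \<and> (\<forall>i<j. R i (g i) (g (Suc i)))"
proof -
  define P where "P j' g \<longleftrightarrow> (\<forall>i\<le>j'. g i \<in> L i) \<and> (\<forall>i<j'. R i (g i) (g (Suc i)))" for j' g
  define reach where "reach j' = {y. \<exists>g. P j' g \<and> g j' = y}" for j'
  have sub: "reach j' \<subseteq> L j'" for j'
    by (auto simp: reach_def P_def)
  have "m \<le> card (reach j')" if "j' \<le> j" for j'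
    using that
  proof (induction j')
    case 0
    have "L 0 \<subseteq> reach 0"
      by (auto simp: reach_def P_def intro: exI[of _ "\<lambda>_. _"])
    then have "reach 0 = L 0" using sub[of 0] by auto
    then show ?case using large[of 0] by simp
  next
    case (Suc j')
    let ?B = "L (Suc j') - reach (Suc j')"
    have "\<not> m \<le> card ?B"
    proof
      assume "m \<le> card ?B"
      then obtain x y where xy: "x \<in> reach j'" "y \<in> ?B" "R j' x y"
        using sep[of j' "reach j'" ?B] Suc sub[of j'] by auto
      then obtain g where g: "P j' g" "g j' = x"
        by (auto simp: reach_def)
      have "P (Suc j') (g(Suc j' := y))"
        using g xy unfolding P_def by (auto simp: le_Suc_eq less_Suc_eq)
      then have "y \<in> reach (Suc j')"
        unfolding reach_def by (auto intro!: exI[of _ "g(Suc j' := y)"])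
      then show False using xy by auto
    qed
    moreover have "card (L (Suc j')) = card (reach (Suc j')) + card ?B"
      using card_Diff_subset[OF finite_subset[OF sub fin[OF Suc.prems]] sub]
        card_mono[OF fin[OF Suc.prems] sub] by simp
    ultimately show ?case using large[OF Suc.prems] by linarith
  qed
  then have "reach j \<noteq> {}" using \<open>m \<ge> 1\<close> by fastforce
  then show ?thesis by (auto simp: reach_def P_def)
qed

lemma disjoint_transversal_paths:
  fixes R :: "nat \<Rightarrow> 'a \<Rightarrow> 'a \<Rightarrow> bool"
  assumes "m \<ge> 1"
    and fin: "\<And>i. i \<le> j \<Longrightarrow> finite (L i)"
    and large: "\<And>i. i \<le> j \<Longrightarrow> t + 2 * m \<le> card (L i)"
    and sep: "\<And>i A B. \<lbrakk>i < j; A \<subseteq> L i; B \<subseteq> L (Suc i); m \<le> card A; m \<le> card B\<rbrakk>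
                \<Longrightarrow> \<exists>x\<in>A. \<exists>y\<in>B. R i x y"
  shows "\<exists>F. (\<forall>s<t. (\<forall>i\<le>j. F s i \<in> L i) \<and> (\<forall>i<j. R i (F s i) (F s (Suc i)))) \<and>
             (\<forall>i\<le>j. inj_on (\<lambda>s. F s i) {..<t})"
  using large
proof (induction t)
  case 0
  then show ?case by simp
next
  case (Suc t)
  then obtain F where F: "\<And>s i. s < t \<Longrightarrow> i \<le> j \<Longrightarrow> F s i \<in> L i"
      "\<And>s i. s < t \<Longrightarrow> i < j \<Longrightarrow> R i (F s i) (F s (Suc i))"
      "\<And>i. i \<le> j \<Longrightarrow> inj_on (\<lambda>s. F s i) {..<t}"
    by (metis add_Suc Suc_leD)
  let ?U = "\<lambda>i. (\<lambda>s. F s i) ` {..<t}"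
  have "2 * m \<le> card (L i - ?U i)" if "i \<le> j" for i
    using diff_card_le_card_Diff[of "?U i" "L i"] card_image_le[of "{..<t}" "\<lambda>s. F s i"]
      Suc.prems[OF that] by simp
  then have "\<exists>g. (\<forall>i\<le>j. g i \<in> L i - ?U i) \<and> (\<forall>i<j. R i (g i) (g (Suc i)))"
    using \<open>m \<ge> 1\<close> fin by (intro transversal_path[of m] sep) auto
  then obtain g where g: "\<And>i. i \<le> j \<Longrightarrow> g i \<in> L i - ?U i" "\<And>i. i < j \<Longrightarrow> R i (g i) (g (Suc i))"
    by blast
  have "inj_on (\<lambda>s. (F(t := g)) s i) {..<Suc t}" if "i \<le> j" for i
  proof -
    have "inj_on (\<lambda>s. (F(t := g)) s i) {..<t}"
      using F(3)[OF that] by (simp add: inj_on_def)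
    moreover have "(F(t := g)) t i \<notin> (\<lambda>s. (F(t := g)) s i) ` ({..<t} - {t})"
      using g(1)[OF that] by auto
    ultimately show ?thesis unfolding lessThan_Suc inj_on_insert by blast
  qed
  then show ?case
    using F g by (intro exI[of _ "F(t := g)"]) (auto simp: less_Suc_eq)
qed

section \<open>Choosing disjoint layers\<close>

lemma disjoint_subsets_of_card:
  assumes "finite I" "finite S" "card I * k \<le> card S"
  shows "\<exists>Z. (\<forall>i\<in>I. Z i \<subseteq> S \<and> card (Z i) = k) \<and> disjoint_family_on Z I"
  using assms(1,3)
proof (induction I rule: finite_induct)
  case empty
  then show ?case by (simp add: disjoint_family_on_def)
next
  case (insert a I)
  then obtain Z where Z: "\<And>i. i \<in> I \<Longrightarrow> Z i \<subseteq> S \<and> card (Z i) = k" "disjoint_family_on Z I"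
    by auto
  let ?U = "\<Union>i\<in>I. Z i"
  have "card ?U \<le> card I * k"
    using card_UN_le[OF insert.hyps(1), of Z] Z(1) by simp
  moreover have "finite ?U"
    using insert.hyps(1) Z(1) \<open>finite S\<close> by (auto intro: finite_subset)
  moreover have "k + card I * k \<le> card S"
    using insert.prems insert.hyps by simp
  ultimately have "k \<le> card (S - ?U)"
    using diff_card_le_card_Diff[of ?U S] by linarith
  then obtain Y where Y: "Y \<subseteq> S - ?U" "card Y = k"
    by (metis obtain_subset_with_card_n)
  have "disjoint_family_on (Z(a := Y)) (insert a I)"
    using insert.hyps Y Z(2) by (fastforce simp: disjoint_family_on_def)
  moreover have "\<forall>i\<in>insert a I. (Z(a := Y)) i \<subseteq> S \<and> card ((Z(a := Y)) i) = k"
    using Z(1) Y by (auto split: if_splits)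
  ultimately show ?case by blast
qed

text \<open>
  A function \<open>f\<close> on vertex pairs encodes a graph with an edge coloring by two colors: \<open>None\<close> means
  that the edge is absent, \<open>Some a\<close> that it is present with color \<open>a\<close>.
\<close>

definition link :: "'a set \<Rightarrow> ('a set \<Rightarrow> bool option) \<Rightarrow> 'a \<Rightarrow> 'a \<Rightarrow> bool option \<Rightarrow> bool option \<Rightarrow> 'a set"
  where "link V f u v s t = {w \<in> V - {u, v}. f {u, w} = s \<and> f {v, w} = t}"

lemma link_swap: "link V f v u t s = link V f u v s t"
  by (auto simp: link_def)

lemma finite_link: "finite V \<Longrightarrow> finite (link V f u v s t)"
  by (auto simp: link_def)

text \<open>
  The common neighbours of \<open>u\<close> and \<open>v\<close> are shared evenly between the two, hence the halves.
\<close>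

definition link_capacity :: "'a set \<Rightarrow> ('a set \<Rightarrow> bool option) \<Rightarrow> 'a \<Rightarrow> 'a \<Rightarrow> bool \<Rightarrow> nat"
  where "link_capacity V f u v a = card (link V f u v (Some a) None)
     + card (link V f u v (Some a) (Some True)) div 2 + card (link V f u v (Some a) (Some False)) div 2"

text \<open>A vertex adjacent to exactly one of \<open>u\<close>, \<open>v\<close> goes to the side
  of that one. The common neighbours with statuses \<open>Some a\<close>, \<open>Some b\<close> are
  cut in two: \<open>U a b\<close> goes to \<open>X' a\<close> and the rest \<open>D a b\<close> to
  \<open>Y' b\<close>. Finally all sets are trimmed to \<open>k\<close> elements.\<close>

lemma disjoint_neighbourhoods:
  assumes "finite V"
    and cap: "\<And>a. k \<le> link_capacity V f u v a" "\<And>a. k \<le> link_capacity V f v u a"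
  obtains X Y where
    "\<And>a. X a \<subseteq> {w \<in> V - {u, v}. f {u, w} = Some a}" "\<And>a. card (X a) = k"
    "\<And>a. Y a \<subseteq> {w \<in> V - {u, v}. f {v, w} = Some a}" "\<And>a. card (Y a) = k"
    "\<And>a b. X a \<inter> Y b = {}"
proof -
  let ?W = "link V f u v"
  note fin = finite_link[OF \<open>finite V\<close>]
  have "\<exists>U. U \<subseteq> ?W (Some a) (Some b) \<and> card U = card (?W (Some a) (Some b)) div 2" for a b
    by (metis obtain_subset_with_card_n div_le_dividend)
  then obtain U where U: "\<And>a b. U a b \<subseteq> ?W (Some a) (Some b)"
      "\<And>a b. card (U a b) = card (?W (Some a) (Some b)) div 2"
    by metis
  have finU: "finite (U a b)" for a b using U(1) fin by (metis finite_subset)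
  define X' where "X' a = ?W (Some a) None \<union> (U a True \<union> U a False)" for a
  define D where "D a b = ?W (Some a) (Some b) - U a b" for a b
  define Y' where "Y' b = ?W None (Some b) \<union> (D True b \<union> D False b)" for b
  \<comment> \<open>The rest is the half rounded up, so the side of \<open>v\<close> also reaches
    its capacity.\<close>
  have cardD: "card (?W (Some a) (Some b)) div 2 \<le> card (D a b)" for a b
    using card_Diff_subset[OF finU U(1), of a b] U(2)[of a b] unfolding D_def by linarith
  have Wdisj: "?W s t \<inter> ?W s' t' = {}" if "s \<noteq> s' \<or> t \<noteq> t'" for s t s' t'
    using that by (auto simp: link_def)
  have DW: "D a b \<subseteq> ?W (Some a) (Some b)" for a b by (auto simp: D_def)
  have finD: "finite (D a b)" for a b using DW fin by (metis finite_subset)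
  have "card (X' a) = card (?W (Some a) None) + (card (U a True) + card (U a False))" for a
  proof -
    have "U a True \<inter> U a False = {}"
      using U(1)[of a True] U(1)[of a False] Wdisj[of "Some a" "Some a" "Some True" "Some False"] by auto
    moreover have "?W (Some a) None \<inter> (U a True \<union> U a False) = {}"
      using U(1)[of a True] U(1)[of a False] Wdisj[of "Some a" "Some a" None] by blast
    ultimately show ?thesis
      unfolding X'_def using finU fin by (simp add: card_Un_disjoint)
  qed
  then have X'k: "k \<le> card (X' a)" for a
    using cap(1)[of a] by (simp add: link_capacity_def U(2))
  have "card (Y' b) = card (?W None (Some b)) + (card (D True b) + card (D False b))" for b
  proof -
    have "D True b \<inter> D False b = {}"
      using DW[of True b] DW[of False b] Wdisj[of "Some True" "Some False" "Some b" "Some b"] by auto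
    moreover have "?W None (Some b) \<inter> (D True b \<union> D False b) = {}"
      using DW[of True b] DW[of False b] Wdisj[of None _ "Some b" "Some b"] by blast
    ultimately show ?thesis
      unfolding Y'_def using finD fin by (simp add: card_Un_disjoint)
  qed
  then have Y'k: "k \<le> card (Y' b)" for b
    using cap(2)[of b] cardD[of True b] cardD[of False b]
    by (simp add: link_capacity_def link_swap[of V f v u])
  have sub: "X' a \<subseteq> {w \<in> V - {u, v}. f {u, w} = Some a}"
      "Y' b \<subseteq> {w \<in> V - {u, v}. f {v, w} = Some b}" for a b
    using U(1)[of a] DW[of _ b] by (auto simp: X'_def Y'_def link_def)
  have "X' a \<inter> Y' b = {}" for a b
  proof -
    \<comment> \<open>For equal indices \<open>D\<close> is the complement of \<open>U\<close>;
      otherwise the two link classes are disjoint.\<close>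
    have "U a b' \<inter> D a' b = {}" for a' b'
      using U(1)[of a b'] DW[of a' b] Wdisj[of "Some a" "Some a'" "Some b'" "Some b"]
      by (cases "a = a' \<and> b = b'") (auto simp: D_def)
    moreover have "?W (Some a) None \<inter> D a' b = {}" "U a b' \<inter> ?W None (Some b) = {}" for a' b'
      using U(1)[of a b'] DW[of a' b] by (auto simp: link_def)
    moreover have "?W (Some a) None \<inter> ?W None (Some b) = {}"
      by (rule Wdisj) simp
    ultimately show ?thesis unfolding X'_def Y'_def by blast
  qed
  note disj = this
  have "\<exists>S. S \<subseteq> X' a \<and> card S = k" "\<exists>S. S \<subseteq> Y' a \<and> card S = k" for a
    using obtain_subset_with_card_n[OF X'k] obtain_subset_with_card_n[OF Y'k] by metis+
  then obtain X Y where XY: "\<And>a. X a \<subseteq> X' a" "\<And>a. card (X a) = k"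
      "\<And>a. Y a \<subseteq> Y' a" "\<And>a. card (Y a) = k"
    by metis
  show ?thesis
  proof (rule that)
    show "X a \<subseteq> {w \<in> V - {u, v}. f {u, w} = Some a}" "Y a \<subseteq> {w \<in> V - {u, v}. f {v, w} = Some a}" for a
      using XY(1,3) sub by (meson order_trans)+
    show "X a \<inter> Y b = {}" for a b
      using XY(1)[of a] XY(3)[of b] disj[of a b] by blast
  qed (fact XY)+
qed

subsection \<open>Alternating paths in pseudorandom colored graphs\<close>

definition present_edges :: "'a set \<Rightarrow> ('a set \<Rightarrow> bool option) \<Rightarrow> 'a set set"
  where "present_edges V f = {e \<in> vertex_pairs V. f e \<noteq> None}"

text \<open>Absent pairs get the default color 0. Only the colors 0 and 1 occur, so this is a legal
  coloring for every \<open>r \<ge> 2\<close>.\<close>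

definition edge_color :: "('a set \<Rightarrow> bool option) \<Rightarrow> 'a set \<Rightarrow> nat"
  where "edge_color f e = of_bool (f e = Some True)"

lemma edge_coloring_edge_color: "r \<ge> 2 \<Longrightarrow> edge_coloring r E (edge_color f)"
  by (auto simp: edge_coloring_def edge_color_def)

text \<open>Edge number \<open>i\<close> of the path, counted from 0, has color \<open>a\<close>
  exactly for even \<open>i\<close>; the Boolean \<open>a = even i\<close> is \<open>a\<close> or
  its negation accordingly. Since \<open>g i\<close> is vertex number \<open>i + 1\<close>, the
  parity in \<open>mid\<close> is shifted, and the last edge has number \<open>l - 1\<close>, which
  is even iff \<open>l\<close> is odd.\<close>

lemma alternating_path_of_transversal:
  fixes f :: "'a set \<Rightarrow> bool option"
  assumes "l \<ge> 3" "u \<in> V" "v \<in> V" "u \<noteq> v"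
    and int: "\<And>i. i < l - 1 \<Longrightarrow> g i \<in> V - {u, v}" "inj_on g {..<l - 1}"
    and first: "f {u, g 0} = Some a"
    and mid: "\<And>i. i < l - 2 \<Longrightarrow> f {g i, g (Suc i)} = Some (a = odd i)"
    and last: "f {v, g (l - 2)} = Some (a = odd l)"
  shows "u # map g [0..<l - 1] @ [v] \<in> alternating_paths V (present_edges V f) (edge_color f) l u v"
proof -
  let ?xs = "u # map g [0..<l - 1] @ [v]"
  have len: "length ?xs = l + 1" using assms(1) by simp
  have nth: "?xs ! i = (if i = 0 then u else if i < l then g (i - 1) else v)" if "i \<le> l" for i
    using that assms(1) by (auto simp: nth_append nth_Cons split: nat.split)
  have dist: "distinct ?xs"
    using int assms(4) by (auto simp: distinct_map atLeast0LessThan)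
  have sub: "set ?xs \<subseteq> V"
    using int(1) assms(2,3) by auto
  have status: "f {?xs ! i, ?xs ! Suc i} = Some (a = even i)" if "Suc i < length ?xs" for i
  proof -
    have "i < l" using that len by linarith
    then consider "i = 0" | "0 < i" "i < l - 1" | "i = l - 1"
      by linarith
    then show ?thesis
    proof cases
      case 1
      then show ?thesis using nth[of 0] nth[of 1] first assms(1) by auto
    next
      case 2
      then obtain i' where "i = Suc i'" by (cases i) auto
      then show ?thesis using nth[of i] nth[of "Suc i"] mid[of i'] 2 by auto
    next
      case 3
      then have "even i = odd l" using assms(1) by auto
      moreover have "i - 1 = l - 2" using 3 by simp
      ultimately show ?thesis
        using nth[of i] nth[of "Suc i"] last 3 assms(1) by (auto simp: insert_commute)
    qed
  qed
  have "{?xs ! i, ?xs ! Suc i} \<in> vertex_pairs V" if "Suc i < length ?xs" for i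
  proof -
    have "?xs ! i \<noteq> ?xs ! Suc i"
      using dist that nth_eq_iff_index_eq[of ?xs i "Suc i"] by linarith
    moreover have "?xs ! i \<in> V" "?xs ! Suc i \<in> V"
      using sub that nth_mem[of i ?xs] nth_mem[of "Suc i" ?xs] by auto
    ultimately show ?thesis by (simp add: vertex_pairs_def)
  qed
  then have "{?xs ! i, ?xs ! Suc i} \<in> present_edges V f" if "Suc i < length ?xs" for i
    using status[OF that] that unfolding present_edges_def by blast
  then have "is_path V (present_edges V f) ?xs"
    using dist sub unfolding is_path_def by blast
  moreover have "alternating (edge_color f) ?xs"
    unfolding alternating_def
  proof (intro allI impI)
    fix i
    assume i: "Suc (Suc i) < length ?xs"
    have "Suc i < length ?xs" using i by linarith
    from status[OF this] status[OF i]
    show "edge_color f {?xs ! i, ?xs ! Suc i} \<noteq> edge_color f {?xs ! Suc i, ?xs ! Suc (Suc i)}"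
      unfolding edge_color_def by auto
  qed
  ultimately show ?thesis
    using len by (simp add: alternating_paths_def)
qed

lemma interior_vertices_Cons_snoc: "interior_vertices (u # xs @ [v]) = set xs"
  by (simp add: interior_vertices_def)

text \<open>
  The paths are found separately for each of the two colors of the first edge. A path of this kind
  visits, one after the other, \<open>l - 1\<close> disjoint layers: a set of neighbours of \<open>u\<close>, then arbitrary
  sets, and a set of neighbours of \<open>v\<close>.
\<close>

lemma alternating_connected_if_pseudorandom:
  fixes f :: "'a set \<Rightarrow> bool option"
  assumes "finite V" "l \<ge> 3" "m \<ge> 1"
    and sep: "\<And>A B a. \<lbrakk>A \<subseteq> V; B \<subseteq> V; A \<inter> B = {}; m \<le> card A; m \<le> card B\<rbrakk>
                \<Longrightarrow> \<exists>x\<in>A. \<exists>y\<in>B. f {x, y} = Some a"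
    and cap: "\<And>u v a. \<lbrakk>u \<in> V; v \<in> V; u \<noteq> v\<rbrakk> \<Longrightarrow> k \<le> link_capacity V f u v a"
    and size: "2 * (l - 1) * k + 2 \<le> card V"
    and t: "t + 2 * m \<le> k"
  shows "alternating_connected V (present_edges V f) (edge_color f) l (2 * t)"
  unfolding alternating_connected_def
proof (intro ballI impI)
  fix u v
  assume uv: "u \<in> V" "v \<in> V" "u \<noteq> v"
  obtain X Y where
    X: "\<And>a. X a \<subseteq> {w \<in> V - {u, v}. f {u, w} = Some a}" "\<And>a. card (X a) = k" and
    Y: "\<And>a. Y a \<subseteq> {w \<in> V - {u, v}. f {v, w} = Some a}" "\<And>a. card (Y a) = k" and
    XY: "\<And>a b. X a \<inter> Y b = {}"
  proof (rule disjoint_neighbourhoods[OF assms(1) cap[OF uv] cap[OF uv(2,1) uv(3)[symmetric]]])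
  qed (rule that)
  let ?U = "\<Union>a. X a \<union> Y a"
  let ?S = "V - {u, v} - ?U"
  have finXY: "finite (X a)" "finite (Y a)" for a
    using finite_subset[OF X(1)] finite_subset[OF Y(1)] assms(1) by auto
  have "card ?U \<le> 4 * k"
  proof -
    have "?U = X True \<union> X False \<union> (Y True \<union> Y False)"
      by (auto simp: UNIV_bool)
    also have "card \<dots> \<le> card (X True) + card (X False) + (card (Y True) + card (Y False))"
      by (meson add_mono card_Un_le order_trans)
    finally show ?thesis by (simp add: X Y)
  qed
  moreover have "card (V - {u, v}) = card V - 2"
    using uv by (simp add: card_Diff_subset)
  moreover have "card (V - {u, v}) - card ?U \<le> card ?S"
    using finXY by (intro diff_card_le_card_Diff) simp
  \<comment> \<open>There are \<open>l - 1\<close> layers for each of the two first colors. The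
    neighbourhood layers take \<open>4 * k\<close> vertices; the other \<open>l - 3\<close> layers
    per color are cut out of \<open>?S\<close>.\<close>
  moreover have "2 * (l - 1) * k = 2 * (l - 3) * k + 4 * k"
    using assms(2) by (simp add: algebra_simps flip: add_mult_distrib)
  moreover have "card ((UNIV :: bool set) \<times> {0<..<l - 2}) = 2 * (l - 3)"
    using assms(2) by (simp add: card_cartesian_product)
  ultimately have "card ((UNIV :: bool set) \<times> {0<..<l - 2}) * k \<le> card ?S"
    using size by simp
  then have "\<exists>Z. (\<forall>p\<in>UNIV \<times> {0<..<l - 2} :: (bool \<times> nat) set. Z p \<subseteq> ?S \<and> card (Z p) = k) \<and>
      disjoint_family_on Z (UNIV \<times> {0<..<l - 2})"
    using assms(1) by (intro disjoint_subsets_of_card) auto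
  then obtain Z where "\<forall>p\<in>UNIV \<times> {0<..<l - 2}. Z p \<subseteq> ?S \<and> card (Z p) = k"
    and Zdisj: "disjoint_family_on Z (UNIV \<times> {0<..<l - 2} :: (bool \<times> nat) set)"
    by blast
  then have Z: "Z (a, i) \<subseteq> ?S" "card (Z (a, i)) = k" if "i \<in> {0<..<l - 2}" for a i
    using that by blast+
  \<comment> \<open>The last layer has to match the color of the last edge. Sending \<open>a\<close>
    to \<open>a = odd l\<close> permutes the colors, so the two families use different sets
    \<open>Y\<close>.\<close>
  define L where "L a i = (if i = 0 then X a else if i = l - 2 then Y (a = odd l) else Z (a, i))" for a i
  have LX: "L a 0 = X a" and LY: "L a (l - 2) = Y (a = odd l)"
    and LZ: "i \<in> {0<..<l - 2} \<Longrightarrow> L a i = Z (a, i)" for a i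
    using assms(2) by (auto simp: L_def)
  have layers: "i = 0 \<or> i = l - 2 \<or> i \<in> {0<..<l - 2}" if "i \<le> l - 2" for i
    using that by auto
  have "X a \<subseteq> V - {u, v}" "Y a \<subseteq> V - {u, v}" for a
    using X(1)[of a] Y(1)[of a] by blast+
  then have LV: "L a i \<subseteq> V - {u, v}" if "i \<le> l - 2" for a i
    using layers[OF that] Z(1)[of i a] LX LY LZ by blast
  have cardL: "card (L a i) = k" if "i \<le> l - 2" for a i
    using X(2) Y(2) Z(2)[of i a] that by (auto simp: L_def)
  \<comment> \<open>Disjointness across the first colors keeps the two families of paths apart;
    within one family it lets \<open>sep\<close> be applied to consecutive layers.\<close>
  have Ldisj: "L a i \<inter> L b j = {}" if "i \<le> l - 2" "j \<le> l - 2" "(a, i) \<noteq> (b, j)" for a b i j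
  proof -
    have XX: "X a \<inter> X b = {}" if "a \<noteq> b" for a b using subsetD[OF X(1)[of a]] subsetD[OF X(1)[of b]] that by fastforce
    have YY: "Y a \<inter> Y b = {}" if "a \<noteq> b" for a b using subsetD[OF Y(1)[of a]] subsetD[OF Y(1)[of b]] that by fastforce
    have ZZ: "Z (a, i) \<inter> Z (b, j) = {}" if "i \<in> {0<..<l-2}" "j \<in> {0<..<l-2}" "(a, i) \<noteq> (b, j)" for a b i j
      using that by (intro disjoint_family_onD[OF Zdisj]) auto
    have ZX: "Z (a, i) \<inter> X b = {}" "X b \<inter> Z (a, i) = {}"
        "Z (a, i) \<inter> Y b = {}" "Y b \<inter> Z (a, i) = {}" if "i \<in> {0<..<l-2}" for a b i
      using Z(1)[OF that] by blast+
    have YX: "Y b \<inter> X a = {}" for a b using XY by blast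
    from layers[OF that(1)] layers[OF that(2)] show ?thesis
      using that(3) by (elim disjE) (auto simp: LX LY LZ XX YY XY YX ZZ ZX)
  qed
  have "\<exists>F. (\<forall>s<t. (\<forall>i\<le>l-2. F s i \<in> L a i) \<and> (\<forall>i<l-2. f {F s i, F s (Suc i)} = Some (a = odd i))) \<and>
             (\<forall>i\<le>l-2. inj_on (\<lambda>s. F s i) {..<t})" for a
  proof (rule disjoint_transversal_paths[OF \<open>m \<ge> 1\<close>])
    show "finite (L a i)" if "i \<le> l - 2" for i
      using LV[OF that] assms(1) by (metis finite_Diff finite_subset)
    show "t + 2 * m \<le> card (L a i)" if "i \<le> l - 2" for i
      using cardL[OF that] t by simp
    show "\<exists>x\<in>A. \<exists>y\<in>B. f {x, y} = Some (a = odd i)"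
      if "i < l - 2" "A \<subseteq> L a i" "B \<subseteq> L a (Suc i)" "m \<le> card A" "m \<le> card B" for i A B
      using that LV[of i a] LV[of "Suc i" a] Ldisj[of i "Suc i" a a] by (intro sep) auto
  qed
  then obtain F where
    FL: "\<And>a s i. s < t \<Longrightarrow> i \<le> l - 2 \<Longrightarrow> F a s i \<in> L a i" and
    Fedge: "\<And>a s i. s < t \<Longrightarrow> i < l - 2 \<Longrightarrow> f {F a s i, F a s (Suc i)} = Some (a = odd i)" and
    Finj: "\<And>a i. i \<le> l - 2 \<Longrightarrow> inj_on (\<lambda>s. F a s i) {..<t}"
    by metis
  \<comment> \<open>A vertex determines its layer by \<open>Ldisj\<close>, hence first color and
    position, and then the path through it by injectivity in \<open>s\<close>.\<close>
  have F_eq: "a = b \<and> s = s' \<and> i = j"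
    if "F a s i = F b s' j" "s < t" "s' < t" "i < l - 1" "j < l - 1" for a b s s' i j
  proof -
    have ij: "i \<le> l - 2" "j \<le> l - 2" using that by auto
    then have "(a, i) = (b, j)"
      using FL[of s i a] FL[of s' j b] that Ldisj[of i j a b] by force
    then show ?thesis using that inj_onD[OF Finj[OF ij(1), of a]] by auto
  qed
  let ?P = "\<lambda>(a, s). u # map (F a s) [0..<l - 1] @ [v]"
  let ?I = "(UNIV :: bool set) \<times> {..<t}"
  have "u # map (F a s) [0..<l - 1] @ [v] \<in> alternating_paths V (present_edges V f) (edge_color f) l u v"
    if s: "s < t" for a s
  proof (rule alternating_path_of_transversal[OF \<open>l \<ge> 3\<close> uv])
    show "F a s i \<in> V - {u, v}" if "i < l - 1" for i
    proof -
      have "i \<le> l - 2" using that by simp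
      then show ?thesis using FL[OF s, of i a] LV[of i a] by blast
    qed
    show "inj_on (F a s) {..<l - 1}"
      using F_eq s by (auto intro!: inj_onI)
    show "f {u, F a s 0} = Some a"
      using FL[OF s, of 0 a] X(1)[of a] by (auto simp: LX LY)
    show "f {v, F a s (l - 2)} = Some (a = odd l)"
      using FL[OF s, of "l - 2" a] Y(1)[of "a = odd l"] assms(2) by (auto simp: LY)
  qed (use Fedge s in auto)
  then have "?P ` ?I \<subseteq> alternating_paths V (present_edges V f) (edge_color f) l u v"
    by auto
  moreover have "inj_on ?P ?I"
  proof (rule inj_onI)
    fix x y
    assume xy: "x \<in> ?I" "y \<in> ?I" "?P x = ?P y"
    obtain a s b s' where eq: "x = (a, s)" "y = (b, s')" by (cases x, cases y)
    \<comment> \<open>The first interior vertex already identifies the path.\<close>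
    then have "F a s 0 = F b s' 0" using xy(3) assms(2) by (simp add: upt_conv_Cons)
    then show "x = y" using F_eq[of a s 0 b s' 0] xy(1,2) eq assms(2) by auto
  qed
  then have "card (?P ` ?I) = 2 * t"
    by (simp add: card_image card_cartesian_product)
  moreover have "internally_disjoint (?P ` ?I)"
    unfolding internally_disjoint_def
  proof (intro pairwiseI)
    fix xs ys
    assume "xs \<in> ?P ` ?I" "ys \<in> ?P ` ?I" "xs \<noteq> ys"
    then obtain a s b s' where "xs = ?P (a, s)" "ys = ?P (b, s')" "s < t" "s' < t" "(a, s) \<noteq> (b, s')"
      by force
    moreover from this have "F a s i \<noteq> F b s' j" if "i < l - 1" "j < l - 1" for i j
      using F_eq[of a s i b s' j] that by blast
    ultimately show "disjnt (interior_vertices xs) (interior_vertices ys)"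
      by (auto simp: interior_vertices_Cons_snoc disjnt_iff)
  qed
  moreover have "finite (?P ` ?I)" by simp
  ultimately show "\<exists>Ps\<subseteq>alternating_paths V (present_edges V f) (edge_color f) l u v.
      finite Ps \<and> card Ps = 2 * t \<and> internally_disjoint Ps"
    by blast
qed

section \<open>Upper bound: counting interior vertices\<close>

text \<open>The traces of the interiors on \<open>D\<close> are disjoint. This is applied with
  \<open>D\<close> the whole vertex set, and with \<open>D\<close> the complement of the common
  non-neighbours of the endpoints.\<close>

lemma internally_disjoint_card_le:
  assumes "finite D" "finite Ps" "internally_disjoint Ps"
    and "\<And>xs. xs \<in> Ps \<Longrightarrow> q \<le> card (interior_vertices xs \<inter> D)"
  shows "q * card Ps \<le> card D"
proof -
  have "q * card Ps \<le> (\<Sum>xs\<in>Ps. card (interior_vertices xs \<inter> D))"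
    using sum_mono[of Ps "\<lambda>_. q"] assms(4) by (simp add: mult.commute)
  also have "\<dots> = card (\<Union>xs\<in>Ps. interior_vertices xs \<inter> D)"
    using assms by (intro card_UN_disjoint[symmetric])
      (auto simp: internally_disjoint_def pairwise_def disjnt_iff)
  also have "\<dots> \<le> card D"
    using assms(1) by (intro card_mono) auto
  finally show ?thesis .
qed

text \<open>
  Since \<open>l \<ge> 3\<close>, the second and the second last vertex of a path from \<open>u\<close> to \<open>v\<close> are distinct interior
  vertices, and each is a neighbour of \<open>u\<close> or \<open>v\<close>.
\<close>

lemma alternating_paths_bounds:
  fixes f :: "'a set \<Rightarrow> bool option"
  assumes "finite V" "l \<ge> 3" "u \<in> V" "v \<in> V" "u \<noteq> v"
    and Ps: "Ps \<subseteq> alternating_paths V (present_edges V f) c l u v" "internally_disjoint Ps"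
  shows "(l - 1) * card Ps \<le> card V"
    and "2 * card Ps + card (link V f u v None None) \<le> card V"
proof -
  have fin: "finite Ps"
    using Ps(1) finite_alternating_paths[OF assms(1)] finite_subset by blast
  have path: "\<exists>ys. xs = u # ys @ [v] \<and> length ys = l - 1 \<and> distinct xs \<and> set ys \<subseteq> V - {u, v} \<and>
      f {u, ys ! 0} \<noteq> None \<and> f {v, ys ! (l - 2)} \<noteq> None" if "xs \<in> Ps" for xs
  proof -
    have xs: "is_path V (present_edges V f) xs" "length xs = l + 1" "hd xs = u" "last xs = v"
      using that Ps(1) by (auto simp: alternating_paths_def)
    then obtain zs where zs: "xs = u # zs" "zs \<noteq> []" using assms(2) by (cases xs) fastforce+
    then obtain ys where ys: "zs = ys @ [v]" using xs by (metis append_butlast_last_id last_ConsR)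
    have len: "length ys = l - 1" using xs zs ys by simp
    have dist: "distinct xs" and edge: "\<And>i. Suc i < length xs \<Longrightarrow> f {xs ! i, xs ! Suc i} \<noteq> None"
      and sub: "set xs \<subseteq> V"
      using xs(1) by (auto simp: is_path_def present_edges_def)
    have "f {u, ys ! 0} \<noteq> None"
      using edge[of 0] zs ys len assms(2) by (simp add: nth_append)
    moreover have "f {v, ys ! (l - 2)} \<noteq> None"
    proof -
      have "xs ! (l - 1) = ys ! (l - 2)" "xs ! Suc (l - 1) = v"
        using zs ys len assms(2) by (auto simp: nth_append nth_Cons' diff_diff_add numeral_2_eq_2)
      then show ?thesis using edge[of "l - 1"] xs(2) assms(2) by (simp add: insert_commute)
    qed
    ultimately show ?thesis using zs ys len dist sub by auto
  qed
  have "l - 1 \<le> card (interior_vertices xs \<inter> V)" if xs: "xs \<in> Ps" for xs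
  proof -
    obtain ys where ys: "xs = u # ys @ [v]" "length ys = l - 1" "distinct xs" "set ys \<subseteq> V - {u, v}"
      using path[OF xs] by blast
    then have "set ys \<inter> V = set ys" by auto
    then show ?thesis using ys by (simp add: interior_vertices_Cons_snoc distinct_card)
  qed
  from internally_disjoint_card_le[OF assms(1) fin Ps(2) this]
  show "(l - 1) * card Ps \<le> card V" .
  let ?D = "V - link V f u v None None"
  have "2 \<le> card (interior_vertices xs \<inter> ?D)" if xs: "xs \<in> Ps" for xs
  proof -
    obtain ys where ys: "xs = u # ys @ [v]" "length ys = l - 1" "distinct xs" "set ys \<subseteq> V - {u, v}"
      "f {u, ys ! 0} \<noteq> None" "f {v, ys ! (l - 2)} \<noteq> None"
      using path[OF xs] by blast
    have "ys ! 0 \<in> set ys" "ys ! (l - 2) \<in> set ys"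
      using assms(2) ys(2) by (auto intro!: nth_mem)
    then have "{ys ! 0, ys ! (l - 2)} \<subseteq> interior_vertices xs \<inter> ?D"
      using ys
      by (auto simp: interior_vertices_Cons_snoc link_def)
    moreover have "card {ys ! 0, ys ! (l - 2)} = 2"
      using ys(2,3) assms(2) by (simp add: ys(1) nth_eq_iff_index_eq)
    ultimately show ?thesis
      using assms(1) by (metis card_mono finite_Diff finite_Int)
  qed
  from internally_disjoint_card_le[OF _ fin Ps(2) this]
  have "2 * card Ps \<le> card ?D" using assms(1) by simp
  moreover have "card ?D + card (link V f u v None None) = card V"
  proof -
    have "link V f u v None None \<subseteq> V" by (auto simp: link_def)
    then show ?thesis
      using card_Diff_subset[OF finite_link[OF assms(1)], of f u v None None] card_mono[OF assms(1)]
      by simp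
  qed
  ultimately show "2 * card Ps + card (link V f u v None None) \<le> card V" by linarith
qed

subsection \<open>Random colored graphs\<close>

lemma finite_vertex_pairs: "finite V \<Longrightarrow> finite (vertex_pairs V)"
  by (rule finite_subset[of _ "Pow V"]) (auto simp: vertex_pairs_def)

text \<open>Two independent coins, for presence and for color, make the presence alone a
  \<open>bernoulli_pmf p\<close>. The color coin is also tossed for absent edges and then
  discarded.\<close>

definition status_pmf :: "real \<Rightarrow> bool option pmf"
  where "status_pmf p = map_pmf (\<lambda>(x, a). if x then Some a else None)
     (pair_pmf (bernoulli_pmf p) (bernoulli_pmf (1 / 2)))"

definition random_status :: "'a set \<Rightarrow> real \<Rightarrow> ('a set \<Rightarrow> bool option) pmf"
  where "random_status V p = Pi_pmf (vertex_pairs V) None (\<lambda>_. status_pmf p)"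

lemma map_status_pmf: "map_pmf (\<lambda>s. s \<noteq> None) (status_pmf p) = bernoulli_pmf p"
proof -
  have "map_pmf (\<lambda>s. s \<noteq> None) (status_pmf p) = map_pmf fst (pair_pmf (bernoulli_pmf p) (bernoulli_pmf (1 / 2)))"
    unfolding status_pmf_def map_pmf_comp by (rule map_pmf_cong) (auto split: if_splits)
  then show ?thesis by (simp add: map_fst_pair_pmf)
qed

text \<open>Coupling: events about \<open>kappa\<close> of the random graph can be bounded in a
  space that also supplies a coloring.\<close>

lemma random_graph_conv_random_status:
  "random_graph n p = map_pmf (present_edges {..<n}) (random_status {..<n} p)"
proof -
  have "Pi_pmf (vertex_pairs {..<n}) False (\<lambda>_. bernoulli_pmf p)
      = map_pmf (\<lambda>h. (\<lambda>s. s \<noteq> None) \<circ> h) (random_status {..<n} p)"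
    unfolding map_status_pmf[symmetric] random_status_def
    by (rule Pi_pmf_map) (simp_all add: finite_vertex_pairs)
  then show ?thesis
    by (simp add: random_graph_def map_pmf_comp present_edges_def[abs_def])
qed

lemma pmf_status:
  assumes "0 < p" "p < 1"
  shows "pmf (status_pmf p) None = 1 - p" "pmf (status_pmf p) (Some a) = p / 2"
proof -
  have "pmf (bernoulli_pmf p) False = measure (status_pmf p) ((\<lambda>s. s \<noteq> None) -` {False})"
    by (metis map_status_pmf pmf_map)
  also have "(\<lambda>s. s \<noteq> None) -` {False} = {None :: bool option}" by auto
  finally show "pmf (status_pmf p) None = 1 - p"
    using assms by (simp add: measure_pmf_single)
  have "(\<lambda>(x, a). if x then Some a else None) -` {Some a} = {(True, a)}"
    by (auto split: if_splits)
  then show "pmf (status_pmf p) (Some a) = p / 2"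
    using assms unfolding status_pmf_def pmf_map
    by (cases a) (simp_all add: measure_pmf_single pmf_pair)
qed

lemma prob_bex_le:
  fixes M :: "'b pmf" and B :: real
  assumes "finite I" "\<And>i. i \<in> I \<Longrightarrow> measure_pmf.prob M {x. P i x} \<le> B"
  shows "measure_pmf.prob M {x. \<exists>i\<in>I. P i x} \<le> card I * B"
proof -
  have "{x. \<exists>i\<in>I. P i x} = (\<Union>i\<in>I. {x. P i x})" by auto
  then have "measure_pmf.prob M {x. \<exists>i\<in>I. P i x} \<le> (\<Sum>i\<in>I. measure_pmf.prob M {x. P i x})"
    using assms(1) by (simp add: measure_pmf.finite_measure_subadditive_finite)
  also have "\<dots> \<le> (\<Sum>i\<in>I. B)" by (intro sum_mono assms(2))
  finally show ?thesis by simp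
qed

text \<open>As \<open>A\<close> and \<open>B\<close> are disjoint, distinct \<open>(x, y)\<close>
  give distinct pairs \<open>{x, y}\<close>, so the event concerns \<open>card A * card B\<close>
  independent statuses.\<close>

lemma prob_no_edge_of_color:
  assumes "finite V" "0 < p" "p < 1" "A \<subseteq> V" "B \<subseteq> V" "A \<inter> B = {}"
  shows "measure_pmf.prob (random_status V p) {f. \<forall>x\<in>A. \<forall>y\<in>B. f {x, y} \<noteq> Some a}
    = (1 - p / 2) ^ (card A * card B)"
proof -
  let ?F = "(\<lambda>(x, y). {x, y}) ` (A \<times> B)"
  \<comment> \<open>Unconstrained pairs get \<open>UNIV\<close>, which contributes a factor 1; this
    makes the event a product over all of \<open>vertex_pairs V\<close>.\<close>
  let ?C = "\<lambda>e. if e \<in> ?F then - {Some a} else UNIV"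
  have FV: "?F \<subseteq> vertex_pairs V"
    using assms(4-6) by (auto simp: vertex_pairs_def card_insert_if)
  have "inj_on (\<lambda>(x, y). {x, y}) (A \<times> B)"
    using assms(6) by (fastforce simp: inj_on_def doubleton_eq_iff)
  then have cardF: "card ?F = card A * card B"
    by (simp add: card_image card_cartesian_product)
  have "{f. \<forall>x\<in>A. \<forall>y\<in>B. f {x, y} \<noteq> Some a} = Pi (vertex_pairs V) ?C"
    using FV by (auto simp: Pi_def)
  then have "measure_pmf.prob (random_status V p) {f. \<forall>x\<in>A. \<forall>y\<in>B. f {x, y} \<noteq> Some a}
      = (\<Prod>e\<in>vertex_pairs V. measure_pmf.prob (status_pmf p) (?C e))"
    unfolding random_status_def using assms(1) by (simp add: measure_Pi_pmf_Pi finite_vertex_pairs)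
  also have "\<dots> = (\<Prod>e\<in>?F. measure_pmf.prob (status_pmf p) (- {Some a}))"
    using FV assms(1) by (intro prod.mono_neutral_cong_right) (auto simp: finite_vertex_pairs)
  also have "measure_pmf.prob (status_pmf p) (- {Some a}) = 1 - p / 2"
    using measure_pmf.prob_compl[of "{Some a}" "status_pmf p"] assms(2,3)
    by (simp add: measure_pmf_single pmf_status Compl_eq_Diff_UNIV)
  finally show ?thesis by (simp add: cardF)
qed

text \<open>Hoeffding's inequality: the indicators for different \<open>w\<close> read disjoint sets
  of pairs and hence are independent. There are \<open>card V - 2\<close> of them, each with the
  product of the two status probabilities as its mean.\<close>

lemma prob_small_link:
  fixes V :: "'a set"
  assumes "finite V" "u \<in> V" "v \<in> V" "u \<noteq> v" "card V \<ge> 3" "h \<ge> 0"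
  shows "measure_pmf.prob (random_status V p)
      {f. card (link V f u v s t) \<le> pmf (status_pmf p) s * pmf (status_pmf p) t * (real (card V) - 2) - h}
    \<le> exp (- 2 * h\<^sup>2 / (real (card V) - 2))"
proof -
  let ?M = "random_status V p"
  let ?I = "V - {u, v}"
  define X :: "'a \<Rightarrow> ('a set \<Rightarrow> bool option) \<Rightarrow> real"
    where "X w f = (if f {u, w} = s \<and> f {v, w} = t then 1 else 0)" for w f
  have cardI: "card ?I = card V - 2" using assms by (simp add: card_Diff_subset)
  let ?K = "\<lambda>w. {{u, w}, {v, w}}"
  have K: "?K w \<subseteq> vertex_pairs V" if "w \<in> ?I" for w
    using that assms(2,3) by (auto simp: vertex_pairs_def card_insert_if)
  have expect: "measure_pmf.expectation ?M (X w) = pmf (status_pmf p) s * pmf (status_pmf p) t"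
    if w: "w \<in> ?I" for w
  proof -
    let ?C = "\<lambda>e. if e = {u, w} then {s} else if e = {v, w} then {t} else UNIV"
    have ne: "{u, w} \<noteq> {v, w}" using assms(4) by (auto simp: doubleton_eq_iff)
    have "f \<in> Pi (vertex_pairs V) ?C \<longleftrightarrow> f {u, w} = s \<and> f {v, w} = t" for f
    proof
      assume "f \<in> Pi (vertex_pairs V) ?C"
      then have "f {u, w} \<in> ?C {u, w}" "f {v, w} \<in> ?C {v, w}"
        using K[OF w] unfolding Pi_iff by blast+
      then show "f {u, w} = s \<and> f {v, w} = t" using ne by simp
    qed simp
    then have "X w = indicator (Pi (vertex_pairs V) ?C)"
      unfolding X_def indicator_def of_bool_def by presburger
    then have "measure_pmf.expectation ?M (X w) = measure_pmf.prob ?M (Pi (vertex_pairs V) ?C)"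
      by simp
    also have "\<dots> = (\<Prod>e\<in>vertex_pairs V. measure_pmf.prob (status_pmf p) (?C e))"
      unfolding random_status_def using assms(1) by (simp add: measure_Pi_pmf_Pi finite_vertex_pairs)
    also have "\<dots> = (\<Prod>e\<in>?K w. measure_pmf.prob (status_pmf p) (?C e))"
      using K[OF w] assms(1) by (intro prod.mono_neutral_right) (auto simp: finite_vertex_pairs)
    also have "\<dots> = pmf (status_pmf p) s * pmf (status_pmf p) t"
      using ne by (simp add: measure_pmf_single)
    finally show ?thesis .
  qed
  have "prob_space.indep_vars ?M (\<lambda>_. count_space UNIV) (\<lambda>e f. f e) (vertex_pairs V)"
    using indep_vars_Pi_pmf[OF finite_vertex_pairs[OF assms(1)], of None "\<lambda>_. status_pmf p"]
    by (simp add: random_status_def)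
  moreover have "disjoint_family_on ?K ?I"
    by (auto simp: disjoint_family_on_def doubleton_eq_iff)
  ultimately have "prob_space.indep_vars ?M (\<lambda>w. PiM (?K w) (\<lambda>_. count_space UNIV))
      (\<lambda>w f. restrict (\<lambda>e. f e) (?K w)) ?I"
    using K by (intro prob_space.indep_vars_restrict[OF prob_space_measure_pmf]) auto
  \<comment> \<open>\<open>X w\<close> reads only the coordinates in \<open>?K w\<close>, so
    independence of the blocks carries over.\<close>
  then have "prob_space.indep_vars ?M (\<lambda>_. borel) (\<lambda>w f. X w (restrict (\<lambda>e. f e) (?K w))) ?I"
  proof (rule prob_space.indep_vars_compose2[OF prob_space_measure_pmf])
    fix w
    have [measurable]: "(\<lambda>g. g {u, w}) \<in> PiM (?K w) (\<lambda>_. count_space UNIV) \<rightarrow>\<^sub>M count_space (UNIV :: bool option set)"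
      "(\<lambda>g. g {v, w}) \<in> PiM (?K w) (\<lambda>_. count_space UNIV) \<rightarrow>\<^sub>M count_space (UNIV :: bool option set)"
      by (rule measurable_component_singleton; simp)+
    show "X w \<in> PiM (?K w) (\<lambda>_. count_space UNIV) \<rightarrow>\<^sub>M borel"
      unfolding X_def by measurable
  qed
  then have indep: "prob_space.indep_vars ?M (\<lambda>_. borel) X ?I"
    unfolding X_def[abs_def] by simp
  interpret H: Hoeffding_ineq ?M ?I X "\<lambda>_. 0" "\<lambda>_. 1" "\<Sum>w\<in>?I. measure_pmf.expectation ?M (X w)"
    by unfold_locales (use assms(1) indep in \<open>auto simp: X_def\<close>)
  have mean: "(\<Sum>w\<in>?I. measure_pmf.expectation ?M (X w)) = pmf (status_pmf p) s * pmf (status_pmf p) t * (real (card V) - 2)"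
    using cardI assms(5) by (simp add: expect of_nat_diff del: Diff_insert0)
  have count: "(\<Sum>w\<in>?I. X w f) = card (link V f u v s t)" for f
  proof -
    have "(\<Sum>w\<in>?I. X w f) = (\<Sum>w\<in>link V f u v s t. 1)"
      using assms(1) by (intro sum.mono_neutral_cong_right) (auto simp: X_def link_def)
    then show ?thesis by simp
  qed
  have "measure_pmf.prob ?M {f \<in> space ?M. (\<Sum>w\<in>?I. X w f) \<le> (\<Sum>w\<in>?I. measure_pmf.expectation ?M (X w)) - h}
      \<le> exp (- 2 * h\<^sup>2 / (\<Sum>w\<in>?I. (1 - 0)\<^sup>2))"
    by (rule H.Hoeffding_ineq_le) (use assms(5,6) cardI in auto)
  then show ?thesis
    unfolding mean count using cardI assms(5) by (simp add: of_nat_diff)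
qed

section \<open>Pseudorandomness and its failure probability\<close>

text \<open>One parameter \<open>h\<close> is both the size threshold and the allowed deviation.
  Lower deviations are enough: the lower bound on \<open>kappa\<close> needs many neighbours of each
  kind, the upper bound many common non-neighbours.\<close>

definition pseudorandom :: "'a set \<Rightarrow> real \<Rightarrow> real \<Rightarrow> ('a set \<Rightarrow> bool option) \<Rightarrow> bool"
  where "pseudorandom V p h f \<longleftrightarrow>
    (\<forall>A B a. A \<subseteq> V \<longrightarrow> B \<subseteq> V \<longrightarrow> A \<inter> B = {} \<longrightarrow> h \<le> card A \<longrightarrow> h \<le> card B \<longrightarrow>
       (\<exists>x\<in>A. \<exists>y\<in>B. f {x, y} = Some a)) \<and>
    (\<forall>u\<in>V. \<forall>v\<in>V. \<forall>s t. u \<noteq> v \<longrightarrow>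
       pmf (status_pmf p) s * pmf (status_pmf p) t * (real (card V) - 2) - h < card (link V f u v s t))"

text \<open>Union bound over at most \<open>4 ^ card V\<close> pairs of sets with 2 colors, and over
  at most \<open>(card V)\<^sup>2\<close> pairs of vertices with \<open>3 * 3\<close> pairs of
  statuses.\<close>

lemma prob_not_pseudorandom:
  fixes V :: "'a set"
  assumes "finite V" "card V \<ge> 3" "0 < p" "p < 1" "h \<ge> 0"
  shows "measure_pmf.prob (random_status V p) {f. \<not> pseudorandom V p h f}
    \<le> 2 * 4 ^ card V * (1 - p / 2) powr h\<^sup>2 + 9 * (real (card V))\<^sup>2 * exp (- 2 * h\<^sup>2 / (real (card V) - 2))"
proof -
  let ?M = "random_status V p"
  define I1 where "I1 = {(A, B, a :: bool). A \<subseteq> V \<and> B \<subseteq> V \<and> A \<inter> B = {} \<and> h \<le> card A \<and> h \<le> card B}"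
  define I2 where "I2 = {(u, v, s :: bool option, t :: bool option). u \<in> V \<and> v \<in> V \<and> u \<noteq> v}"
  let ?P1 = "\<lambda>(A, B, a) f. \<forall>x\<in>A. \<forall>y\<in>B. f {x, y} \<noteq> Some a"
  let ?P2 = "\<lambda>(u, v, s, t) f. card (link V f u v s t)
    \<le> pmf (status_pmf p) s * pmf (status_pmf p) t * (real (card V) - 2) - h"
  have "I1 \<subseteq> Pow V \<times> Pow V \<times> UNIV" by (auto simp: I1_def)
  moreover have "card (Pow V \<times> Pow V \<times> (UNIV :: bool set)) = 2 * 4 ^ card V"
    using assms(1) by (simp add: card_cartesian_product card_Pow flip: power_mult_distrib)
  ultimately have I1: "finite I1" "card I1 \<le> 2 * 4 ^ card V"
    using assms(1) by (metis finite_Pow_iff finite_SigmaI finite finite_subset)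
      (metis \<open>I1 \<subseteq> _\<close> \<open>card (Pow V \<times> _) = _\<close> assms(1) card_mono finite finite_Pow_iff finite_SigmaI)
  have "I2 \<subseteq> V \<times> V \<times> UNIV \<times> UNIV" by (auto simp: I2_def)
  moreover have "card (V \<times> V \<times> (UNIV :: bool option set) \<times> (UNIV :: bool option set)) = 9 * (card V)\<^sup>2"
    using assms(1) by (simp add: card_cartesian_product power2_eq_square card_UNIV_option)
  ultimately have I2: "finite I2" "card I2 \<le> 9 * (card V)\<^sup>2"
    using assms(1) by (metis finite_SigmaI finite finite_subset)
      (metis \<open>I2 \<subseteq> _\<close> \<open>card (V \<times> _) = _\<close> assms(1) card_mono finite finite_SigmaI)
  have "measure_pmf.prob ?M {f. ?P1 i f} \<le> (1 - p / 2) powr h\<^sup>2" if i: "i \<in> I1" for i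
  proof -
    obtain A B a where AB: "i = (A, B, a)" "A \<subseteq> V" "B \<subseteq> V" "A \<inter> B = {}" "h \<le> card A" "h \<le> card B"
      using i by (auto simp: I1_def)
    have "measure_pmf.prob ?M {f. ?P1 i f} = (1 - p / 2) ^ (card A * card B)"
      using prob_no_edge_of_color[of V p A B a] assms AB by simp
    also have "\<dots> = (1 - p / 2) powr (real (card A) * real (card B))"
      using assms by (simp flip: powr_realpow)
    also have "\<dots> \<le> (1 - p / 2) powr h\<^sup>2"
      unfolding power2_eq_square using assms AB by (intro powr_mono' mult_mono) auto
    finally show ?thesis .
  qed
  from prob_bex_le[of I1 ?M ?P1, OF I1(1) this]
  have "measure_pmf.prob ?M {f. \<exists>i\<in>I1. ?P1 i f} \<le> card I1 * (1 - p / 2) powr h\<^sup>2" .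
  also have "\<dots> \<le> 2 * 4 ^ card V * (1 - p / 2) powr h\<^sup>2"
    using I1(2) by (intro mult_right_mono) (auto simp flip: of_nat_le_iff[where 'a = real])
  finally have 1: "measure_pmf.prob ?M {f. \<exists>i\<in>I1. ?P1 i f} \<le> 2 * 4 ^ card V * (1 - p / 2) powr h\<^sup>2" .
  have "measure_pmf.prob ?M {f. ?P2 i f} \<le> exp (- 2 * h\<^sup>2 / (real (card V) - 2))" if "i \<in> I2" for i
    using that prob_small_link[OF assms(1) _ _ _ assms(2,5)] by (auto simp: I2_def)
  from prob_bex_le[of I2 ?M ?P2, OF I2(1) this]
  have "measure_pmf.prob ?M {f. \<exists>i\<in>I2. ?P2 i f} \<le> card I2 * exp (- 2 * h\<^sup>2 / (real (card V) - 2))" .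
  also have "\<dots> \<le> 9 * (real (card V))\<^sup>2 * exp (- 2 * h\<^sup>2 / (real (card V) - 2))"
    using I2(2) by (intro mult_right_mono) (auto simp flip: of_nat_le_iff[where 'a = real])
  finally have 2: "measure_pmf.prob ?M {f. \<exists>i\<in>I2. ?P2 i f}
    \<le> 9 * (real (card V))\<^sup>2 * exp (- 2 * h\<^sup>2 / (real (card V) - 2))" .
  have "{f. \<not> pseudorandom V p h f} \<subseteq> {f. \<exists>i\<in>I1. ?P1 i f} \<union> {f. \<exists>i\<in>I2. ?P2 i f}"
  proof (rule subsetI, rule ccontr)
    fix f
    assume f: "f \<in> {f. \<not> pseudorandom V p h f}"
      "f \<notin> {f. \<exists>i\<in>I1. ?P1 i f} \<union> {f. \<exists>i\<in>I2. ?P2 i f}"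
    have "\<exists>x\<in>A. \<exists>y\<in>B. f {x, y} = Some a"
      if "A \<subseteq> V" "B \<subseteq> V" "A \<inter> B = {}" "h \<le> card A" "h \<le> card B" for A B a
    proof -
      have "(A, B, a) \<in> I1" using that by (simp add: I1_def)
      then have "\<not> ?P1 (A, B, a) f" using f(2) by blast
      then show ?thesis by simp
    qed
    moreover have "pmf (status_pmf p) s * pmf (status_pmf p) t * (real (card V) - 2) - h
        < card (link V f u v s t)" if "u \<in> V" "v \<in> V" "u \<noteq> v" for u v s t
    proof -
      have "(u, v, s, t) \<in> I2" using that by (simp add: I2_def)
      then have "\<not> ?P2 (u, v, s, t) f" using f(2) by blast
      then show ?thesis by simp
    qed
    ultimately have "pseudorandom V p h f"
      unfolding pseudorandom_def by blast
    then show False using f(1) by simp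
  qed
  then have "measure_pmf.prob ?M {f. \<not> pseudorandom V p h f}
      \<le> measure_pmf.prob ?M ({f. \<exists>i\<in>I1. ?P1 i f} \<union> {f. \<exists>i\<in>I2. ?P2 i f})"
    by (intro measure_pmf.finite_measure_mono) auto
  also have "\<dots> \<le> measure_pmf.prob ?M {f. \<exists>i\<in>I1. ?P1 i f} + measure_pmf.prob ?M {f. \<exists>i\<in>I2. ?P2 i f}"
    by (rule measure_Un_le) auto
  finally show ?thesis using 1 2 by linarith
qed

subsection \<open>Concentration\<close>

text \<open>The constant is generous: the lower bound loses less than \<open>8 * h + 10\<close>,
  which is at most \<open>18 * h\<close> as \<open>h \<ge> 1\<close>, and the upper bound loses
  less.\<close>

lemma kappa_close:
  fixes V :: "'a set" and p h :: real
  assumes "finite V" "card V \<ge> 3" "l \<ge> 3" "r \<ge> 2" "0 < p" "p < 1" "h \<ge> 1"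
    and pr: "pseudorandom V p h f"
  shows "\<bar>real (kappa r l V (present_edges V f)) - min (card V / (real l - 1)) (card V * p * (1 - p / 2))\<bar>
    \<le> 18 * h"
proof -
  let ?n = "real (card V)"
  let ?K = "kappa r l V (present_edges V f)"
  define g where "g = min (?n / (real l - 1)) (?n * p * (1 - p / 2))"
  define q where "q = ?n * p * (1 - p / 2)"
  have g_le: "g \<le> ?n / (real l - 1)" "g \<le> q"
    unfolding g_def q_def by simp_all
  note pmf = pmf_status[OF assms(5,6)]
  have link: "pmf (status_pmf p) s * pmf (status_pmf p) t * (?n - 2) - h < card (link V f u v s t)"
    if "u \<in> V" "v \<in> V" "u \<noteq> v" for u v s t
    using conjunct2[OF pr[unfolded pseudorandom_def]] that by auto
  have "?K \<le> g + 18 * h"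
  proof -
    obtain u v where uv: "u \<in> V" "v \<in> V" "u \<noteq> v"
    proof -
      obtain T where "T \<subseteq> V" "card T = 2"
        using obtain_subset_with_card_n[of 2 V] assms(2) by auto
      then show ?thesis using that by (auto simp: card_2_iff)
    qed
    obtain c where "alternating_connected V (present_edges V f) c l ?K"
      using kappa_attained[of V r "present_edges V f" l] assms(1,2,4) by auto
    then obtain Ps where Ps: "Ps \<subseteq> alternating_paths V (present_edges V f) c l u v" "card Ps = ?K"
        "internally_disjoint Ps"
      using uv unfolding alternating_connected_def by blast
    note bounds = alternating_paths_bounds[OF assms(1,3) uv Ps(1,3)]
    have "real ((l - 1) * ?K) \<le> ?n" using bounds(1) Ps(2) by (simp only: of_nat_le_iff)
    then have "?K \<le> ?n / (real l - 1)"
      using assms(3) by (simp add: field_simps of_nat_diff)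
    \<comment> \<open>All but about \<open>(1 - p)\<^sup>2 * ?n\<close> vertices are adjacent to
      \<open>u\<close> or \<open>v\<close>, and
      \<open>1 - (1 - p)\<^sup>2 = 2 * p * (1 - p / 2)\<close>.\<close>
    moreover have "2 * ?K \<le> 2 * q + 2 * (1 - p)\<^sup>2 + h"
      using bounds(2) Ps(2) link[OF uv, of None None]
      by (simp add: q_def pmf power2_eq_square algebra_simps)
    moreover have "(1 - p)\<^sup>2 \<le> 1" using assms(5,6) by (simp add: power_le_one)
    ultimately have "?K \<le> ?n / (real l - 1) + 18 * h" "?K \<le> q + 18 * h"
      using assms(7) by linarith+
    then show ?thesis unfolding g_def q_def by linarith
  qed
  moreover have "g - 18 * h \<le> ?K"
  proof (cases "g / 2 - 2 * h - 2 < 0")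
    case True
    \<comment> \<open>Here \<open>g < 4 * h + 4\<close>, which is at most \<open>8 * h\<close>, so
      the claim is trivial.\<close>
    then have "g - 18 * h \<le> 0" using assms(7) by linarith
    then show ?thesis by (meson of_nat_0_le_iff order_trans)
  next
    case False
    define m where "m = nat \<lceil>h\<rceil>"
    \<comment> \<open>In the capacity, the deviations cost \<open>2 * h\<close>, the two halvings
      together at most 1, and passing from \<open>?n - 2\<close> to \<open>?n\<close> at most 1. The
      same slack leaves room for all layers in \<open>V\<close>.\<close>
    define k where "k = nat \<lfloor>g / 2 - 2 * h - 2\<rfloor>"
    have m: "h \<le> m" "m < h + 1" "m \<ge> 1" using assms(7) unfolding m_def by linarith+
    have k: "k \<le> g / 2 - 2 * h - 2" "g / 2 - 2 * h - 3 < k" using False unfolding k_def by linarith+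
    have "k \<le> link_capacity V f u v a" if uv: "u \<in> V" "v \<in> V" "u \<noteq> v" for u v a
    proof -
      let ?c = "\<lambda>t. real (card (link V f u v (Some a) t))"
      have half: "real (x div 2) \<ge> real x / 2 - 1 / 2" for x :: nat by linarith
      have "real (link_capacity V f u v a) \<ge> ?c None + ?c (Some True) / 2 + ?c (Some False) / 2 - 1"
        unfolding link_capacity_def of_nat_add
        using half[of "card (link V f u v (Some a) (Some True))"]
          half[of "card (link V f u v (Some a) (Some False))"] by linarith
      also have "?c None + ?c (Some True) / 2 + ?c (Some False) / 2 - 1
          \<ge> (p / 2 * (1 - p) + p / 2 * (p / 2)) * (?n - 2) - 2 * h - 1"
        using link[OF uv, of "Some a" None] link[OF uv, of "Some a" "Some True"]
          link[OF uv, of "Some a" "Some False"] unfolding pmf distrib_right by linarith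
      \<comment> \<open>Each color at \<open>v\<close> contributes half of
        \<open>(p / 2)\<^sup>2\<close>. The sum is \<open>p / 2 * (1 - p / 2)\<close>, half of the
        target density, since each first color supplies half of the paths.\<close>
      also have "(p / 2 * (1 - p) + p / 2 * (p / 2)) * (?n - 2) = q / 2 - p * (1 - p / 2)"
        by (simp add: q_def field_simps)
      finally have "q / 2 - p * (1 - p / 2) - 2 * h - 1 \<le> real (link_capacity V f u v a)" .
      moreover have "p * (1 - p / 2) \<le> 1 * 1"
        using assms(5,6) by (intro mult_mono) auto
      ultimately have "real (link_capacity V f u v a) \<ge> q / 2 - 2 * h - 2" by linarith
      then have "real k \<le> link_capacity V f u v a" using k(1) g_le by linarith
      then show ?thesis by simp
    qed
    moreover have "2 * (l - 1) * k + 2 \<le> card V"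
    proof -
      have l: "real l - 1 \<ge> 2" using assms(3) by simp
      define y where "y = ?n / (real l - 1)"
      have "real k \<le> y / 2 - 1" using k(1) g_le(1) assms(7) unfolding y_def[symmetric] by linarith
      then have "2 * (real l - 1) * real k \<le> 2 * (real l - 1) * (y / 2 - 1)"
        using l by (intro mult_left_mono) auto
      also have "\<dots> = ?n - 2 * (real l - 1)" using l by (simp add: y_def field_simps)
      finally have "real (2 * (l - 1) * k + 2) \<le> ?n" using l assms(3) by (simp add: of_nat_diff)
      then show ?thesis by (simp only: of_nat_le_iff)
    qed
    moreover have "\<exists>x\<in>A. \<exists>y\<in>B. f {x, y} = Some a"
      if "A \<subseteq> V" "B \<subseteq> V" "A \<inter> B = {}" "m \<le> card A" "m \<le> card B" for A B a
    proof -
      have "h \<le> card A" "h \<le> card B" using that m(1) by linarith+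
      then show ?thesis using conjunct1[OF pr[unfolded pseudorandom_def]] that by auto
    qed
    ultimately have conn: "alternating_connected V (present_edges V f) (edge_color f) l (2 * t)"
      if "t + 2 * m \<le> k" for t
      using that assms(1,3) m(3) by (intro alternating_connected_if_pseudorandom[of V l m f k t])
    have "2 * (k - 2 * m) \<le> ?K" if "2 * m \<le> k"
      using assms(1,2) edge_coloring_edge_color[OF assms(4)] conn[of "k - 2 * m"] that
      by (intro kappa_upper) auto
    \<comment> \<open>For \<open>k < 2 * m\<close> the left-hand side is negative.\<close>
    then have "2 * (real k - 2 * real m) \<le> ?K"
      by (cases "2 * m \<le> k") (simp_all add: of_nat_diff flip: of_nat_le_iff[where 'a = real])
    moreover have "2 * (real k - 2 * real m) > g - 8 * h - 10"
      using k(2) m(2) by argo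
    ultimately show ?thesis using assms(7) by linarith
  qed
  ultimately show ?thesis unfolding g_def by linarith
qed

theorem theorem1p2:
  fixes p :: real and r l :: nat
  assumes "0 < p" and "p < 1" and "r \<ge> 2" and "l \<ge> 3"
  shows "whp_asymp_equiv (\<lambda>n. random_graph n p)
           (\<lambda>n E. real (kappa r l {..<n} E))
           (\<lambda>n. min (real n / (real l - 1)) (real n * p * (1 - p / 2)))"
proof -
  \<comment> \<open>Any exponent strictly between 1/2 and 1 would do: \<open>h n\<close> must be
    \<open>o(n)\<close> for the error, while \<open>(h n)\<^sup>2\<close> must beat
    \<open>n * ln 4\<close> from the pairs of sets and \<open>(h n)\<^sup>2 / n\<close> must beat
    the logarithm of the number of vertex pairs.\<close>
  define h where "h n = real n powr (3 / 4)" for n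
  define C where "C = min (1 / (real l - 1)) (p * (1 - p / 2))"
  let ?g = "\<lambda>n. min (real n / (real l - 1)) (real n * p * (1 - p / 2))"
  have "C > 0" using assms by (simp add: C_def)
  have g: "?g n = real n * C" for n
    using min_mult_distrib_left[of "real n" "1 / (real l - 1)" "p * (1 - p / 2)"]
    by (simp add: C_def mult.assoc)
  \<comment> \<open>The target is linear in \<open>n\<close> with slope \<open>C\<close>, so this
    turns the absolute error \<open>18 * h n\<close> into a relative one.\<close>
  define \<delta> where "\<delta> n = 18 / C * (h n / real n)" for n
  define c where "c = - ln (1 - p / 2)"
  have "c > 0" using assms by (simp add: c_def)
  \<comment> \<open>The bound of \<open>prob_not_pseudorandom\<close> at \<open>h n\<close>, with
    \<open>4 ^ n\<close> and the power of \<open>1 - p / 2\<close> merged into one exponential and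
    \<open>n - 2\<close> replaced by \<open>n\<close>.\<close>
  define err where "err n = 2 * exp (real n * ln 4 - c * real n powr (3 / 2))
      + 9 * (real n)\<^sup>2 * exp (- 2 * real n powr (1 / 2))" for n
  have "(\<lambda>n. h n / real n) \<longlonglongrightarrow> 0"
    unfolding h_def by real_asymp
  then have "\<delta> \<longlonglongrightarrow> 0"
    unfolding \<delta>_def by (intro tendsto_mult_right_zero)
  have "(\<lambda>n. exp (real n * ln 4 - c * real n powr (3 / 2))) \<longlonglongrightarrow> 0"
    using \<open>c > 0\<close> by real_asymp
  moreover have "(\<lambda>n. (real n)\<^sup>2 * exp (- 2 * real n powr (1 / 2))) \<longlonglongrightarrow> 0"
    by real_asymp
  ultimately have "err \<longlonglongrightarrow> 2 * 0 + 9 * 0"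
    unfolding err_def mult.assoc by (intro tendsto_add tendsto_mult_left)
  then have lim: "(\<lambda>n. 1 - err n) \<longlonglongrightarrow> 1"
    using tendsto_diff[OF tendsto_const, of err 0 sequentially 1] by simp
  let ?E = "\<lambda>n. {E. \<bar>real (kappa r l {..<n} E) - ?g n\<bar> \<le> \<delta> n * \<bar>?g n\<bar>}"
  have "1 - err n \<le> measure_pmf.prob (random_graph n p) (?E n)" if n: "n \<ge> 3" for n
  proof -
    let ?M = "random_status {..<n} p"
    have h1: "h n \<ge> 1" unfolding h_def using n by (intro ge_one_powr_ge_zero) auto
    have hsq: "(h n)\<^sup>2 = real n powr (3 / 2)"
      using n by (simp add: h_def powr_power)
    have "18 * h n = \<delta> n * \<bar>?g n\<bar>"
      unfolding g \<delta>_def using \<open>C > 0\<close> n by simp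
    then have "{f. pseudorandom {..<n} p (h n) f} \<subseteq> present_edges {..<n} -` ?E n"
      using kappa_close[of "{..<n}" l r p "h n"] assms n h1 by auto
    then have "measure_pmf.prob ?M {f. pseudorandom {..<n} p (h n) f}
        \<le> measure_pmf.prob ?M (present_edges {..<n} -` ?E n)"
      by (intro measure_pmf.finite_measure_mono) auto
    also have "\<dots> = measure_pmf.prob (random_graph n p) (?E n)"
      by (simp add: random_graph_conv_random_status)
    finally have 1: "measure_pmf.prob ?M {f. pseudorandom {..<n} p (h n) f}
      \<le> measure_pmf.prob (random_graph n p) (?E n)" .
    have "1 - measure_pmf.prob ?M {f. pseudorandom {..<n} p (h n) f}
        = measure_pmf.prob ?M {f. \<not> pseudorandom {..<n} p (h n) f}"
      using measure_pmf.prob_compl[of "{f. pseudorandom {..<n} p (h n) f}" ?M]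
      by (simp add: Collect_neg_eq Compl_eq_Diff_UNIV)
    also have "\<dots> \<le> 2 * 4 ^ n * (1 - p / 2) powr (h n)\<^sup>2
        + 9 * (real n)\<^sup>2 * exp (- 2 * (h n)\<^sup>2 / (real n - 2))"
      using prob_not_pseudorandom[of "{..<n}" p "h n"] n assms h1 by simp
    also have "\<dots> \<le> err n"
      unfolding err_def
    proof (intro add_mono mult_left_mono)
      have "4 ^ n * (1 - p / 2) powr (h n)\<^sup>2 = exp (real n * ln 4 - c * real n powr (3 / 2))"
      proof -
        have "4 ^ n = exp (real n * ln 4)" by (simp add: exp_of_nat_mult)
        moreover have "(1 - p / 2) powr (h n)\<^sup>2 = exp (- (c * real n powr (3 / 2)))"
          using assms unfolding hsq c_def by (simp add: powr_def mult.commute)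
        ultimately show ?thesis by (simp only: mult_exp_exp diff_conv_add_uminus)
      qed
      then show "2 * 4 ^ n * (1 - p / 2) powr (h n)\<^sup>2 \<le> 2 * exp (real n * ln 4 - c * real n powr (3 / 2))"
        by simp
      have "real n powr (1 / 2) * (real n - 2) \<le> real n powr (1 / 2) * real n"
        by (intro mult_left_mono) auto
      also have "\<dots> = (h n)\<^sup>2"
        using n powr_mult_base[of "real n" "1 / 2"] by (simp add: hsq mult.commute)
      finally have "real n powr (1 / 2) \<le> (h n)\<^sup>2 / (real n - 2)"
        using n by (simp add: field_simps)
      then show "exp (- 2 * (h n)\<^sup>2 / (real n - 2)) \<le> exp (- 2 * real n powr (1 / 2))"
        by simp
    qed simp
    finally show ?thesis using 1 by linarith
  qed
  then have lower: "\<forall>\<^sub>F n in sequentially. 1 - err n \<le> measure_pmf.prob (random_graph n p) (?E n)"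
    by (auto simp: eventually_sequentially)
  have "(\<lambda>n. measure_pmf.prob (random_graph n p) (?E n)) \<longlonglongrightarrow> 1"
    by (rule tendsto_sandwich[OF lower _ lim tendsto_const]) (simp add: measure_pmf.prob_le_1)
  then show ?thesis
    unfolding whp_asymp_equiv_def with_high_probability_def using \<open>\<delta> \<longlonglongrightarrow> 0\<close> by blast
qed


end
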